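(* Let $n,d\ge 1$, let $\mathbf b=(b_1,\dots,b_n)\in\mathbb Z^n$, let $M$ be an $n\times d$ column-convex $\{0,1\}$-matrix with no identically zero column, and let $G$ be its associated graph. Then the polytope $\mathcal B_{M,\mathbf b}$ is integrally equivalent to the flow polytope $\mathcal F_G(\mathbf a)$, where $$\mathbf a=(b_1,\,b_2-b_1,\,\dots,\,b_n-b_{n-1},\,-b_n)\in\mathbb Z^{n+1}.$$
   Context: A $\{0,1\}$-matrix $M$ is column convex if whenever $i<i'$ and $M_{i,j}=M_{i',j}=1$, then $M_{k,j}=1$ for all $i\le k\le i'$ (the $1$'s in every column are contiguous). For an $n\times d$ matrix $M$ and $\mathbf b\in\mathbb Z^n$, $\mathcal B_{M,\mathbf b}=\{\mathbf z\in\mathbb R^d_{\ge 0} : M\mathbf z\le\mathbf b\}$ (entrywise inequality). Associated graph: for a column-convex $n\times d$ matrix $M$ with no zero columns, $G$ is the directed multigraph with vertex set $[n+1]=\{1,\dots,n+1\}$ and $n+d$ edges: an edge $x_i=(i,i+1)$ for each $i=1,\dots,n$, and for each column $j$ of $M$, whose nonzero entries occupy exactly rows $i_j,\dots,i_j'-1$, an edge $y_j=(i_j,i_j')$. An edge $(i,i')$ has tail $i$ and head $i'$. Flow polytope: for a directed graph $G$ on $[n+1]$ and $\mathbf a\in\mathbb Z^{n+1}$ with entries summing to $0$, an $\mathbf a$-flow is a tuple $(f_e)_{e\in E(G)}$ of nonnegative reals such that for every $i=1,\dots,n+1$, $a_i+\sum_{\mathrm{head}(e)=i}f_e=\sum_{\mathrm{tail}(e)=i}f_e$.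 $\mathcal F_G(\mathbf a)\subset\mathbb R^{E(G)}$ is the set of all $\mathbf a$-flows. Integral equivalence: polytopes $\mathcal P\subset\mathbb R^m$ and $\mathcal Q\subset\mathbb R^{m'}$ are integrally equivalent if there is an affine map $\varphi:\mathbb R^m\to\mathbb R^{m'}$ that restricts to a bijection $\mathcal P\to\mathcal Q$ and preserves the lattice, i.e. restricts to a bijection $\mathbb Z^m\cap\mathrm{aff}(\mathcal P)\to\mathbb Z^{m'}\cap\mathrm{aff}(\mathcal Q)$. *)

theory Defs
  imports "HOL-Analysis.Analysis" "Graph_Theory.Digraph"
begin

text \<open>
  Rows and columns of an \<open>n \<times> d\<close> matrix are indexed by finite types, so that
  \<open>n = CARD('n)\<close> and \<open>d = CARD('d)\<close> are arbitrary positive integers. The row type is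
  linearly ordered, and \<open>row_number\<close> is the order isomorphism from it to \<open>{1..n}\<close>.
\<close>

definition row_number :: "'n::{finite,linorder} \<Rightarrow> nat"
  where "row_number i = card {k. k \<le> i}"

lemma strict_mono_row_number: "strict_mono (row_number :: 'n::{finite,linorder} \<Rightarrow> nat)"
proof (rule strict_monoI)
  fix x y :: 'n assume "x < y"
  then have "{..x} \<subset> {..y}" by (auto simp: psubset_eq)
  then show "row_number x < row_number y"
    unfolding row_number_def atMost_def by (intro psubset_card_mono) auto
qed

lemma inj_row_number: "inj (row_number :: 'n::{finite,linorder} \<Rightarrow> nat)"
  by (rule strict_mono_imp_inj_on[OF strict_mono_row_number])

lemma range_row_number:
  "range (row_number :: 'n::{finite,linorder} \<Rightarrow> nat) = {1..CARD('n)}"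
proof (rule card_subset_eq)
  have "1 \<le> row_number i" for i :: 'n
    unfolding row_number_def by (auto simp: Suc_le_eq card_gt_0_iff)
  moreover have "row_number i \<le> CARD('n)" for i :: 'n
    unfolding row_number_def by (rule card_mono) auto
  ultimately show "range (row_number :: 'n \<Rightarrow> nat) \<subseteq> {1..CARD('n)}" by auto
qed (simp_all add: card_image inj_row_number)

definition column_convex :: "real^'d^'n::{finite,linorder} \<Rightarrow> bool"
  where "column_convex M \<longleftrightarrow>
    (\<forall>j i i'. i < i' \<and> M $ i $ j = 1 \<and> M $ i' $ j = 1 \<longrightarrow>
      (\<forall>k. i \<le> k \<and> k \<le> i' \<longrightarrow> M $ k $ j = 1))"

definition B_polytope :: "real^'d^'n \<Rightarrow> int^'n \<Rightarrow> (real^'d) set"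
  where "B_polytope M b = {z. 0 \<le> z \<and> M *v z \<le> (\<chi> i. real_of_int (b $ i))}"

text \<open>
  The arc \<open>Inl i\<close> is \<open>x\<^sub>i\<close> and the arc \<open>Inr j\<close> is \<open>y\<^sub>j\<close>.
\<close>

definition assoc_graph :: "real^'d^'n::{finite,linorder} \<Rightarrow> (nat, 'n + 'd) pre_digraph"
  where "assoc_graph M =
    \<lparr> verts = {1..CARD('n) + 1},
      arcs = UNIV,
      tail = case_sum row_number (\<lambda>j. Min (row_number ` {i. M $ i $ j \<noteq> 0})),
      head = case_sum (\<lambda>i. row_number i + 1) (\<lambda>j. Max (row_number ` {i. M $ i $ j \<noteq> 0}) + 1) \<rparr>"

text \<open>
  For column-convex matrices without zero columns, the tail and head of \<open>y\<^sub>j\<close> are the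
  \<open>i\<^sub>j\<close> and \<open>i'\<^sub>j\<close> for which the nonzero entries of column \<open>j\<close> occupy exactly the rows
  \<open>i\<^sub>j, \<dots>, i'\<^sub>j - 1\<close>.
\<close>

lemma assoc_graph_column_arc:
  fixes M :: "real^'d^'n::{finite,linorder}"
  assumes "\<forall>i j. M $ i $ j \<in> {0, 1}" "column_convex M" "\<exists>i. M $ i $ j \<noteq> 0"
  shows "row_number ` {i. M $ i $ j \<noteq> 0} =
    {tail (assoc_graph M) (Inr j)..<head (assoc_graph M) (Inr j)}"
proof -
  let ?R = "row_number ` {i. M $ i $ j \<noteq> 0}"
  have fin: "finite ?R" and ne: "?R \<noteq> {}" using assms(3) by auto
  obtain p where p: "M $ p $ j = 1" "row_number p = Min ?R"
  proof -
    obtain p where "M $ p $ j \<noteq> 0" "Min ?R = row_number p"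
      using Min_in[OF fin ne] by (elim imageE) simp
    moreover from this have "M $ p $ j = 1" using assms(1) by blast
    ultimately show ?thesis using that by simp
  qed
  obtain q where q: "M $ q $ j = 1" "row_number q = Max ?R"
  proof -
    obtain q where "M $ q $ j \<noteq> 0" "Max ?R = row_number q"
      using Max_in[OF fin ne] by (elim imageE) simp
    moreover from this have "M $ q $ j = 1" using assms(1) by blast
    ultimately show ?thesis using that by simp
  qed
  have "?R = {Min ?R..Max ?R}"
  proof
    show "?R \<subseteq> {Min ?R..Max ?R}" using fin by auto
    show "{Min ?R..Max ?R} \<subseteq> ?R"
    proof
      fix k assume k: "k \<in> {Min ?R..Max ?R}"
      moreover have "row_number p \<in> {1..CARD('n)}" "row_number q \<in> {1..CARD('n)}"
        using range_row_number[where ?'n='n] by blast+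
      ultimately have "k \<in> {1..CARD('n)}" using p(2) q(2) by simp
      then have "k \<in> range (row_number :: 'n \<Rightarrow> nat)"
        by (simp only: range_row_number)
      then obtain r :: 'n where r: "k = row_number r" by blast
      have "row_number p \<le> row_number r" "row_number r \<le> row_number q"
        using k unfolding p(2) q(2) r by simp_all
      then have pr: "p \<le> r" "r \<le> q"
        by (simp_all only: strict_mono_less_eq[OF strict_mono_row_number])
      have "M $ r $ j = 1"
      proof (cases "p = q")
        case True
        then show ?thesis using pr p(1) by simp
      next
        case False
        then have "p < q" using pr by simp
        then show ?thesis using assms(2) p(1) q(1) pr unfolding column_convex_def by blast
      qed
      then show "k \<in> ?R" using r by auto
    qed
  qed
  then show ?thesis
    by (simp add: assoc_graph_def atLeastLessThanSuc_atLeastAtMost)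
qed

text \<open>
  \<open>\<real>\<^bsup>E(G)\<^esup>\<close> is the coordinate subspace of \<open>real^'e\<close> spanned by the arcs of \<open>G\<close>, which is
  all of \<open>real^'e\<close> when \<open>arcs G = UNIV\<close>.
\<close>

definition flow_polytope :: "('v, 'e::finite) pre_digraph \<Rightarrow> ('v \<Rightarrow> int) \<Rightarrow> (real^'e) set"
  where "flow_polytope G a =
    {f. (\<forall>e. e \<notin> arcs G \<longrightarrow> f $ e = 0) \<and>
        (\<forall>e\<in>arcs G. 0 \<le> f $ e) \<and>
        (\<forall>v\<in>verts G.
          real_of_int (a v) + (\<Sum>e | e \<in> arcs G \<and> head G e = v. f $ e) =
          (\<Sum>e | e \<in> arcs G \<and> tail G e = v. f $ e))}"

definition netflow :: "int^'n::{finite,linorder} \<Rightarrow> nat \<Rightarrow> int"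
  where "netflow b k =
    (let n = CARD('n); b' = (\<lambda>k. b $ inv row_number k)
     in if k = 1 then b' 1 else if k = n + 1 then - b' n else b' k - b' (k - 1))"

definition integer_lattice :: "(real^'m) set"
  where "integer_lattice = {x. \<forall>i. x $ i \<in> \<int>}"

definition affine_map :: "(real^'m \<Rightarrow> real^'k) \<Rightarrow> bool"
  where "affine_map \<phi> \<longleftrightarrow> (\<exists>f c. linear f \<and> \<phi> = (\<lambda>x. f x + c))"

definition integrally_equivalent :: "(real^'m) set \<Rightarrow> (real^'k) set \<Rightarrow> bool"
  where "integrally_equivalent P Q \<longleftrightarrow> polytope P \<and> polytope Q \<and>
    (\<exists>\<phi>. affine_map \<phi> \<and> bij_betw \<phi> P Q \<and>
      bij_betw \<phi> (integer_lattice \<inter> affine hull P) (integer_lattice \<inter> affine hull Q))"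

end

theory Submission
  imports Defs
begin

text \<open>
  The slack variables \<open>b - M z\<close> turn \<open>B_polytope M b\<close> into the set of nonnegative solutions
  of \<open>x + M z = b\<close>. Adding up the conservation equations of the vertices \<open>1, \<dots>, k\<close> leaves
  exactly the arcs that cross the cut between \<open>k\<close> and \<open>k + 1\<close>; these are \<open>x\<^sub>k\<close> and the \<open>y\<^sub>j\<close> with
  \<open>M\<^sub>k\<^sub>j = 1\<close>, while the net flows telescope to \<open>b\<^sub>k\<close>. So the flow equations are equivalent to
  \<open>x + M z = b\<close>, and \<open>z \<mapsto> (b - M z, z)\<close> is the desired integral equivalence.
\<close>

section \<open>Affine maps and integral equivalence\<close>

definition slack_map :: "real^'d^'n \<Rightarrow> int^'n \<Rightarrow> real^'d \<Rightarrow> real^('n + 'd)"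
  where "slack_map M b z =
    (\<chi> e. case e of Inl i \<Rightarrow> real_of_int (b $ i) - (M *v z) $ i | Inr j \<Rightarrow> z $ j)"

lemma slack_map_nth [simp]:
  "slack_map M b z $ Inl i = real_of_int (b $ i) - (M *v z) $ i"
  "slack_map M b z $ Inr j = z $ j"
  by (simp_all add: slack_map_def)

lemma inj_slack_map: "inj (slack_map M b)"
  by (rule injI) (metis slack_map_nth(2) vec_eq_iff)

lemma slack_map_eq_linear_plus:
  obtains f where "linear f" "slack_map M b = (\<lambda>z. f z + slack_map M b 0)"
proof
  let ?f = "\<lambda>z. slack_map M b z - slack_map M b 0"
  show "linear ?f"
  proof (rule linearI)
    show "?f (x + y) = ?f x + ?f y" for x y
      by (simp add: vec_eq_iff slack_map_def matrix_vector_right_distrib split: sum.split)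
    show "?f (c *\<^sub>R x) = c *\<^sub>R ?f x" for c x
      by (simp add: vec_eq_iff slack_map_def matrix_vector_mult_scaleR split: sum.split)
  qed
  show "slack_map M b = (\<lambda>z. ?f z + slack_map M b 0)" by simp
qed

lemma affine_map_slack_map: "affine_map (slack_map M b)"
proof -
  obtain f where "linear f" "slack_map M b = (\<lambda>z. f z + slack_map M b 0)"
    by (rule slack_map_eq_linear_plus)
  then show ?thesis unfolding affine_map_def by blast
qed

text \<open>Splitting the image into a linear image followed by a translation lets facts about
  polytopes and affine hulls carry over in two standard steps.\<close>

lemma affine_map_image:
  assumes "affine_map \<phi>"
  obtains f c where "linear f" "\<And>S. \<phi> ` S = (+) c ` f ` S"
proof -
  from assms obtain f c where "linear f" and \<phi>: "\<phi> = (\<lambda>x. f x + c)"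
    unfolding affine_map_def by blast
  moreover have "\<phi> ` S = (+) c ` f ` S" for S
    by (simp add: \<phi> image_image add.commute)
  ultimately show ?thesis using that by blast
qed

lemma polytope_affine_map_image: "affine_map \<phi> \<Longrightarrow> polytope P \<Longrightarrow> polytope (\<phi> ` P)"
  by (erule affine_map_image) (simp add: polytope_linear_image polytope_translation_eq)

lemma affine_hull_affine_map_image: "affine_map \<phi> \<Longrightarrow> affine hull (\<phi> ` P) = \<phi> ` (affine hull P)"
  by (erule affine_map_image)
    (simp add: affine_hull_linear_image affine_hull_translation linear_conv_bounded_linear)

text \<open>Injectivity gives both bijections once the images are known. For the lattice part,
  \<open>\<phi>\<close> commutes with affine hulls and both preserves and reflects
  integrality.\<close>

lemma integrally_equivalent_affine_image:
  assumes "affine_map \<phi>" "inj \<phi>" "polytope P"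
    and "\<And>x. \<phi> x \<in> integer_lattice \<longleftrightarrow> x \<in> integer_lattice"
  shows "integrally_equivalent P (\<phi> ` P)"
proof -
  have "\<phi> ` (integer_lattice \<inter> affine hull P) = integer_lattice \<inter> affine hull (\<phi> ` P)"
    using assms(4) by (auto simp: affine_hull_affine_map_image[OF assms(1)])
  then show ?thesis
    unfolding integrally_equivalent_def bij_betw_def
    using assms(1,3) polytope_affine_map_image[OF assms(1,3)] inj_on_subset[OF assms(2) subset_UNIV]
    by blast
qed

text \<open>Integrality is reflected because \<open>z\<close> is a block of coordinates of its
  image, and preserved because \<open>M\<close> and \<open>b\<close> have integer entries.\<close>

lemma slack_map_in_integer_lattice:
  assumes "\<forall>i j. M $ i $ j \<in> {0, 1}"
  shows "slack_map M b z \<in> integer_lattice \<longleftrightarrow> z \<in> integer_lattice"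
proof
  assume "slack_map M b z \<in> integer_lattice"
  then show "z \<in> integer_lattice"
    unfolding integer_lattice_def mem_Collect_eq by (metis slack_map_nth(2))
next
  assume z: "z \<in> integer_lattice"
  have "M $ i $ j \<in> \<int>" for i j using assms by (metis Ints_0 Ints_1 empty_iff insert_iff)
  then have "(M *v z) $ i \<in> \<int>" for i
    using z by (auto simp: integer_lattice_def matrix_vector_mult_def intro!: Ints_sum Ints_mult)
  then show "slack_map M b z \<in> integer_lattice"
    using z by (auto simp: integer_lattice_def slack_map_def split: sum.split)
qed

section \<open>Boundedness of the domain polytope\<close>

lemma polytope_B_polytope:
  fixes M :: "real^'d^'n"
  assumes "\<forall>i j. M $ i $ j \<in> {0, 1}" "\<forall>j. \<exists>i. M $ i $ j \<noteq> 0"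
  shows "polytope (B_polytope M b)"
proof -
  have B: "B_polytope M b =
    \<Inter> (range (\<lambda>j. {z. axis j 1 \<bullet> z \<ge> 0}) \<union> range (\<lambda>i. {z. M $ i \<bullet> z \<le> real_of_int (b $ i)}))"
    by (auto simp: B_polytope_def less_eq_vec_def inner_axis' matrix_vector_mul_component)
  have "polyhedron (B_polytope M b)"
    unfolding B by (rule polyhedron_Inter) (auto simp: polyhedron_halfspace_le polyhedron_halfspace_ge)
  moreover have "bounded (B_polytope M b)"
  proof -
    \<comment> \<open>Row \<open>r j\<close> meets column \<open>j\<close> in a 1. All terms of that
      row are nonnegative, so its inequality alone bounds \<open>z $ j\<close> by
      \<open>b $ r j\<close>.\<close>
    from assms obtain r where r: "M $ r j $ j = 1" for j
      by (metis empty_iff insert_iff)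
    have "z $ j \<in> {0..real_of_int (b $ r j)}" if z: "z \<in> B_polytope M b" for z j
    proof -
      have z0: "0 \<le> z $ k" for k using z by (simp add: B_polytope_def less_eq_vec_def)
      have "0 \<le> M $ i $ k" for i k
        using assms(1) by (metis empty_iff insert_iff order.refl zero_le_one)
      then have "M $ r j $ j * z $ j \<le> (\<Sum>k\<in>UNIV. M $ r j $ k * z $ k)"
        using z0 by (intro member_le_sum) auto
      also have "\<dots> \<le> real_of_int (b $ r j)"
        using z by (simp add: B_polytope_def less_eq_vec_def matrix_vector_mult_def)
      finally show ?thesis using r z0 by simp
    qed
    then have "B_polytope M b \<subseteq> cbox 0 (\<chi> j. real_of_int (b $ r j))"
      by (auto simp: mem_box_cart)
    then show ?thesis using bounded_cbox bounded_subset by blast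
  qed
  ultimately show ?thesis by (simp add: polytope_eq_bounded_polyhedron)
qed

section \<open>Conservation equations and cut equations\<close>

text \<open>Let \<open>c k\<close> be the flow across the cut after \<open>k\<close>. Conservation
  at \<open>v\<close> says that \<open>c - \<beta>\<close> takes the same value at
  \<open>v - 1\<close> and \<open>v\<close>. Both functions vanish at \<open>0\<close> and at
  \<open>Suc n\<close>, so conservation everywhere amounts to \<open>c = \<beta>\<close> in
  between.\<close>

lemma conservation_iff_cuts:
  fixes s t :: "'e::finite \<Rightarrow> nat" and f :: "'e \<Rightarrow> real" and \<beta> :: "nat \<Rightarrow> real"
  assumes st: "\<And>e. 0 < s e" "\<And>e. s e < t e" "\<And>e. t e \<le> Suc n"
    and \<beta>: "\<beta> 0 = 0" "\<beta> (Suc n) = 0"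
  shows "(\<forall>v\<in>{1..Suc n}. \<beta> v - \<beta> (v - 1) + (\<Sum>e | t e = v. f e) = (\<Sum>e | s e = v. f e)) \<longleftrightarrow>
    (\<forall>k\<in>{1..n}. (\<Sum>e | s e \<le> k \<and> k < t e. f e) = \<beta> k)"
proof -
  define c where "c k = (\<Sum>e | s e \<le> k \<and> k < t e. f e)" for k
  have "\<not> s e \<le> 0" "\<not> Suc n < t e" for e
    using st(1,3)[of e] by linarith+
  then have c0: "c 0 = 0" and cn: "c (Suc n) = 0"
    by (simp_all only: c_def simp_thms Collect_empty_eq sum.empty empty_def[symmetric])
  \<comment> \<open>Moving the cut past vertex \<open>Suc k\<close> drops the arcs that end there
    and picks up those that start there. Both sides sum over the arcs whose closed span contains
    \<open>Suc k\<close>.\<close>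
  have c_Suc: "c (Suc k) + (\<Sum>e | t e = Suc k. f e) = c k + (\<Sum>e | s e = Suc k. f e)" for k
  proof -
    have "c (Suc k) + (\<Sum>e | t e = Suc k. f e) =
        (\<Sum>e | (s e \<le> Suc k \<and> Suc k < t e) \<or> t e = Suc k. f e)"
      unfolding c_def Collect_disj_eq by (rule sum.union_disjoint[symmetric]) auto
    also have "{e. (s e \<le> Suc k \<and> Suc k < t e) \<or> t e = Suc k} =
        {e. (s e \<le> k \<and> k < t e) \<or> s e = Suc k}"
    proof (rule Collect_cong)
      show "(s e \<le> Suc k \<and> Suc k < t e) \<or> t e = Suc k \<longleftrightarrow> (s e \<le> k \<and> k < t e) \<or> s e = Suc k" for e
        using st(2)[of e] by linarith
    qed
    also have "(\<Sum>e | (s e \<le> k \<and> k < t e) \<or> s e = Suc k. f e) = c k + (\<Sum>e | s e = Suc k. f e)"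
      unfolding c_def Collect_disj_eq by (rule sum.union_disjoint) auto
    finally show ?thesis .
  qed
  have "(\<forall>v\<in>{1..Suc n}. \<beta> v - \<beta> (v - 1) + (\<Sum>e | t e = v. f e) = (\<Sum>e | s e = v. f e)) \<longleftrightarrow>
      (\<forall>k\<le>n. \<beta> (Suc k) - \<beta> k + (\<Sum>e | t e = Suc k. f e) = (\<Sum>e | s e = Suc k. f e))"
    (is "?L \<longleftrightarrow> _")
  proof -
    \<comment> \<open>Writing \<open>v = Suc k\<close> removes the truncated subtraction in
      \<open>v - 1\<close>.\<close>
    have "{1..Suc n} = Suc ` {..n}" by (simp add: image_Suc_atMost)
    then show ?thesis by (simp only: ball_simps) (simp add: Ball_def)
  qed
  also have "\<dots> \<longleftrightarrow> (\<forall>k\<le>n. c (Suc k) - \<beta> (Suc k) = c k - \<beta> k)"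
  proof -
    have "\<beta> (Suc k) - \<beta> k + (\<Sum>e | t e = Suc k. f e) = (\<Sum>e | s e = Suc k. f e) \<longleftrightarrow>
        c (Suc k) - \<beta> (Suc k) = c k - \<beta> k" for k
      using c_Suc[of k] by auto
    then show ?thesis by simp
  qed
  also have "\<dots> \<longleftrightarrow> (\<forall>k\<in>{1..n}. c k = \<beta> k)"
  proof
    assume *: "\<forall>k\<le>n. c (Suc k) - \<beta> (Suc k) = c k - \<beta> k"
    have "k \<le> n \<Longrightarrow> c k - \<beta> k = 0" for k
      using * by (induction k) (auto simp: c0 \<beta>)
    then show "\<forall>k\<in>{1..n}. c k = \<beta> k" by auto
  next
    assume *: "\<forall>k\<in>{1..n}. c k = \<beta> k"
    \<comment> \<open>The cut equations cover only \<open>1\<close> to \<open>n\<close>; the two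
      outer values come from the boundary conditions.\<close>
    have "c k = \<beta> k" if "k \<le> Suc n" for k
    proof (cases "k = 0 \<or> k = Suc n")
      case True
      then show ?thesis using c0 cn \<beta> by auto
    next
      case False
      then show ?thesis using * that by simp
    qed
    then show "\<forall>k\<le>n. c (Suc k) - \<beta> (Suc k) = c k - \<beta> k" by simp
  qed
  finally show ?thesis unfolding c_def .
qed

section \<open>Cuts of the associated graph\<close>

lemma tail_head_assoc_graph:
  fixes M :: "real^'d^'n::{finite,linorder}"
  assumes "\<forall>i j. M $ i $ j \<in> {0, 1}" "column_convex M" "\<forall>j. \<exists>i. M $ i $ j \<noteq> 0"
  shows "0 < tail (assoc_graph M) e" "tail (assoc_graph M) e < head (assoc_graph M) e"
    "head (assoc_graph M) e \<le> Suc (CARD('n))"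
proof -
  have r: "row_number i \<in> {1..CARD('n)}" for i :: 'n
    using range_row_number[where ?'n='n] by blast
  have "0 < tail (assoc_graph M) e \<and> tail (assoc_graph M) e < head (assoc_graph M) e \<and>
    head (assoc_graph M) e \<le> Suc (CARD('n))"
  proof (cases e)
    case (Inl i)
    then show ?thesis using r[of i] by (simp add: assoc_graph_def)
  next
    case (Inr j)
    let ?s = "tail (assoc_graph M) (Inr j)" and ?t = "head (assoc_graph M) (Inr j)"
    have R: "row_number ` {i. M $ i $ j \<noteq> 0} = {?s..<?t}"
      using assoc_graph_column_arc assms by blast
    moreover have "row_number ` {i. M $ i $ j \<noteq> 0} \<noteq> {}" using assms(3) by auto
    ultimately have lt: "?s < ?t" by simp
    \<comment> \<open>The first and last rows of the column are \<open>?s\<close> and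
      \<open>?t - 1\<close>, so the head is at most one more than the number of rows.\<close>
    then have "?s \<in> {?s..<?t}" "?t - 1 \<in> {?s..<?t}" by auto
    then have "?s \<in> {1..CARD('n)}" "?t - 1 \<in> {1..CARD('n)}"
      using R r by (metis (no_types, lifting) imageE)+
    then show ?thesis using lt Inr by auto
  qed
  then show "0 < tail (assoc_graph M) e" "tail (assoc_graph M) e < head (assoc_graph M) e"
    "head (assoc_graph M) e \<le> Suc (CARD('n))" by auto
qed

text \<open>The arc of row \<open>i'\<close> spans a single step, so it crosses the cut after row
  \<open>i\<close> only if \<open>i' = i\<close>. By column convexity the arc of column
  \<open>j\<close> spans exactly the support of that column, so it crosses if and only if row
  \<open>i\<close> lies in the support.\<close>

lemma cut_flow_assoc_graph:
  fixes M :: "real^'d^'n::{finite,linorder}"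
  assumes "\<forall>i j. M $ i $ j \<in> {0, 1}" "column_convex M" "\<forall>j. \<exists>i. M $ i $ j \<noteq> 0"
  shows "(\<Sum>e | tail (assoc_graph M) e \<le> row_number i \<and> row_number i < head (assoc_graph M) e. f $ e) =
    f $ Inl i + (M *v (\<chi> j. f $ Inr j)) $ i"
proof -
  let ?G = "assoc_graph M"
  have x: "tail ?G (Inl i') \<le> row_number i \<and> row_number i < head ?G (Inl i') \<longleftrightarrow> i' = i" for i'
    by (auto simp: assoc_graph_def less_Suc_eq_le dest: inj_row_number[THEN injD, OF antisym])
  have y: "tail ?G (Inr j) \<le> row_number i \<and> row_number i < head ?G (Inr j) \<longleftrightarrow> M $ i $ j = 1" for j
  proof -
    have "row_number i \<in> {tail ?G (Inr j)..<head ?G (Inr j)} \<longleftrightarrow> M $ i $ j \<noteq> 0"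
      using assoc_graph_column_arc[OF assms(1,2) assms(3)[rule_format], of j, symmetric]
      by (simp add: inj_image_mem_iff[OF inj_row_number])
    also have "\<dots> \<longleftrightarrow> M $ i $ j = 1" using assms(1) by (metis empty_iff insert_iff zero_neq_one)
    finally show ?thesis by simp
  qed
  have "{e. tail ?G e \<le> row_number i \<and> row_number i < head ?G e} =
      insert (Inl i) (Inr ` {j. M $ i $ j = 1})" (is "?C = _")
  proof (rule set_eqI)
    show "e \<in> ?C \<longleftrightarrow> e \<in> insert (Inl i) (Inr ` {j. M $ i $ j = 1})" for e
      using x y by (cases e) auto
  qed
  then have "(\<Sum>e\<in>?C. f $ e) = f $ Inl i + (\<Sum>j | M $ i $ j = 1. f $ Inr j)"
    by (simp add: sum.reindex image_iff)
  also have "(\<Sum>j | M $ i $ j = 1. f $ Inr j) = (\<Sum>j\<in>UNIV. M $ i $ j * f $ Inr j)"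
  proof (rule sum.mono_neutral_cong_left)
    show "\<forall>j\<in>UNIV - {j. M $ i $ j = 1}. M $ i $ j * f $ Inr j = 0"
      using assms(1) by auto
  qed auto
  finally show ?thesis by (simp add: matrix_vector_mult_def)
qed

lemma mem_flow_polytope_assoc_graph_iff:
  fixes M :: "real^'d^'n::{finite,linorder}"
  assumes "\<forall>i j. M $ i $ j \<in> {0, 1}" "column_convex M" "\<forall>j. \<exists>i. M $ i $ j \<noteq> 0"
  shows "f \<in> flow_polytope (assoc_graph M) (netflow b) \<longleftrightarrow>
    (\<forall>e. 0 \<le> f $ e) \<and> (\<forall>i. f $ Inl i + (M *v (\<chi> j. f $ Inr j)) $ i = real_of_int (b $ i))"
proof -
  let ?G = "assoc_graph M" and ?n = "CARD('n)"
  \<comment> \<open>Extending \<open>b\<close> by zero beyond both ends makes all three cases of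
    \<open>netflow\<close> the same difference \<open>\<beta> v - \<beta> (v - 1)\<close> and
    supplies the boundary conditions for the cut argument.\<close>
  define \<beta> where "\<beta> k = (if k \<in> {1..?n} then real_of_int (b $ inv row_number k) else 0)" for k
  have \<beta>_row: "\<beta> (row_number i) = real_of_int (b $ i)" for i
  proof -
    have "row_number i \<in> {1..?n}" using range_row_number[where ?'n='n] by blast
    then show ?thesis by (simp add: \<beta>_def inv_f_f[OF inj_row_number])
  qed
  have net: "real_of_int (netflow b v) = \<beta> v - \<beta> (v - 1)" if "v \<in> {1..Suc ?n}" for v
  proof -
    \<comment> \<open>This keeps the first and last vertices distinct, so the cases of
      \<open>netflow\<close> do not collide.\<close>
    have "0 < ?n" by simp
    with that show ?thesis
      by (cases "v = Suc ?n") (auto simp: netflow_def Let_def \<beta>_def)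
  qed
  have G: "arcs ?G = UNIV" "verts ?G = {1..Suc ?n}" by (simp_all add: assoc_graph_def)
  have "f \<in> flow_polytope ?G (netflow b) \<longleftrightarrow> (\<forall>e. 0 \<le> f $ e) \<and>
      (\<forall>v\<in>{1..Suc ?n}. \<beta> v - \<beta> (v - 1) + (\<Sum>e | head ?G e = v. f $ e) = (\<Sum>e | tail ?G e = v. f $ e))"
    using net by (simp add: flow_polytope_def G)
  also have "(\<forall>v\<in>{1..Suc ?n}. \<beta> v - \<beta> (v - 1) + (\<Sum>e | head ?G e = v. f $ e) = (\<Sum>e | tail ?G e = v. f $ e))
    \<longleftrightarrow> (\<forall>k\<in>{1..?n}. (\<Sum>e | tail ?G e \<le> k \<and> k < head ?G e. f $ e) = \<beta> k)"
    by (rule conservation_iff_cuts) (use tail_head_assoc_graph[OF assms] in \<open>simp_all add: \<beta>_def\<close>)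
  also have "\<dots> \<longleftrightarrow> (\<forall>i::'n. f $ Inl i + (M *v (\<chi> j. f $ Inr j)) $ i = real_of_int (b $ i))"
    unfolding range_row_number[where ?'n='n, symmetric]
    by (simp add: cut_flow_assoc_graph[OF assms] \<beta>_row)
  finally show ?thesis .
qed

text \<open>Under the slack map, \<open>M *v z \<le> b\<close> becomes nonnegativity of the
  \<open>Inl\<close> coordinates and \<open>0 \<le> z\<close> that of the \<open>Inr\<close>
  coordinates; the balance equations hold by construction.\<close>

lemma slack_map_image_B_polytope:
  fixes M :: "real^'d^'n::{finite,linorder}"
  assumes "\<forall>i j. M $ i $ j \<in> {0, 1}" "column_convex M" "\<forall>j. \<exists>i. M $ i $ j \<noteq> 0"
  shows "slack_map M b ` B_polytope M b = flow_polytope (assoc_graph M) (netflow b)"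
proof (intro equalityI subsetI)
  fix f assume "f \<in> slack_map M b ` B_polytope M b"
  then obtain z where z: "z \<in> B_polytope M b" "f = slack_map M b z" by blast
  have "0 \<le> f $ e" for e
    using z by (cases e) (auto simp: B_polytope_def less_eq_vec_def)
  then show "f \<in> flow_polytope (assoc_graph M) (netflow b)"
    by (simp add: mem_flow_polytope_assoc_graph_iff[OF assms] z(2))
next
  fix f assume "f \<in> flow_polytope (assoc_graph M) (netflow b)"
  then have f: "\<And>e. 0 \<le> f $ e"
    "\<And>i. f $ Inl i + (M *v (\<chi> j. f $ Inr j)) $ i = real_of_int (b $ i)"
    by (auto simp: mem_flow_polytope_assoc_graph_iff[OF assms])
  let ?z = "\<chi> j. f $ Inr j"
  \<comment> \<open>The balance equations determine the \<open>Inl\<close> coordinates of a flow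
    from its \<open>Inr\<close> coordinates, so the preimage is found by projection.\<close>
  have "f $ e = slack_map M b ?z $ e" for e
    using f(2) by (cases e) (auto simp: algebra_simps)
  then have "f = slack_map M b ?z" unfolding vec_eq_iff by blast
  moreover have "(M *v ?z) $ i \<le> real_of_int (b $ i)" for i
    using f(1)[of "Inl i"] f(2)[of i] by linarith
  then have "?z \<in> B_polytope M b"
    using f(1) by (simp add: B_polytope_def less_eq_vec_def)
  ultimately show "f \<in> slack_map M b ` B_polytope M b" by blast
qed

theorem theorem2p7:
  fixes M :: "real^'d^'n::{finite,linorder}" and b :: "int^'n::{finite,linorder}"
  assumes "\<forall>i j. M $ i $ j \<in> {0, 1}"
    and "column_convex M"
    and "\<forall>j. \<exists>i. M $ i $ j \<noteq> 0"
  shows "integrally_equivalent (B_polytope M b) (flow_polytope (assoc_graph M) (netflow b))"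
  unfolding slack_map_image_B_polytope[OF assms, symmetric]
  by (rule integrally_equivalent_affine_image[OF affine_map_slack_map inj_slack_map
      polytope_B_polytope[OF assms(1,3)] slack_map_in_integer_lattice[OF assms(1)]])

end
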